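(* Let $S$ be a multiplicatively closed subset of a ring $R$ and let $N$, $K$ be two submodules of an $R$-module $M$ with $K\subseteq N$. (1) If $N$ is a weakly $S$-prime submodule of $M$, then $N/K$ is a weakly $S$-prime submodule of $M/K$. (2) If $K^{\prime}$ is a weakly $S$-prime submodule of $M$ with $(K^{\prime}:_{R}N)\cap S=\emptyset$, then $K^{\prime}\cap N$ is a weakly $S$-prime submodule of $N$. (3) If $N/K$ is a weakly $S$-prime submodule of $M/K$ and $K$ is an $S$-prime submodule of $M$, then $N$ is an $S$-prime submodule of $M$. (4) If $N/K$ is a weakly $S$-prime submodule of $M/K$ and $K$ is a weakly $S$-prime submodule of $M$, then $N$ is a weakly $S$-prime submodule of $M$.
   Context: Rings are commutative with non-zero identity and modules are unital. A non-empty subset $S$ of $R$ is multiplicatively closed if it is closed under multiplication. For submodules $N,K$ of $M$, $(N:_{R}K)=\{r\in R: rK\subseteq N\}$. A submodule $N$ of an $R$-module $M$ with $(N:_{R}M)\cap S=\emptyset$ is $S$-prime (respectively weakly $S$-prime) if there exists a fixed $s\in S$ such that for all $a\in R$, $m\in M$ with $am\in N$ (respectively $0\neq am\in N$), either $sa\in(N:_{R}M)$ or $sm\in N$. *)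

theory Defs
  imports "HOL-Algebra.Module" "HOL-Algebra.AbelCoset"
begin

definition mult_closed :: "('a, 'r) ring_scheme \<Rightarrow> 'a set \<Rightarrow> bool" where
  "mult_closed R S \<longleftrightarrow>
     S \<subseteq> carrier R \<and> S \<noteq> {} \<and> (\<forall>s\<in>S. \<forall>t\<in>S. s \<otimes>\<^bsub>R\<^esub> t \<in> S)"

definition colon :: "('a, 'r) ring_scheme \<Rightarrow> ('a, 'b, 'm) module_scheme \<Rightarrow> 'b set \<Rightarrow> 'b set \<Rightarrow> 'a set" where
  "colon R M N K = {r \<in> carrier R. (\<lambda>x. r \<odot>\<^bsub>M\<^esub> x) ` K \<subseteq> N}"

definition S_prime ::
  "('a, 'r) ring_scheme \<Rightarrow> 'a set \<Rightarrow> ('a, 'b, 'm) module_scheme \<Rightarrow> 'b set \<Rightarrow> bool" where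
  "S_prime R S M N \<longleftrightarrow>
     submodule N R M \<and>
     colon R M N (carrier M) \<inter> S = {} \<and>
     (\<exists>s\<in>S. \<forall>a\<in>carrier R. \<forall>m\<in>carrier M.
        a \<odot>\<^bsub>M\<^esub> m \<in> N \<longrightarrow>
        s \<otimes>\<^bsub>R\<^esub> a \<in> colon R M N (carrier M) \<or> s \<odot>\<^bsub>M\<^esub> m \<in> N)"

definition weakly_S_prime ::
  "('a, 'r) ring_scheme \<Rightarrow> 'a set \<Rightarrow> ('a, 'b, 'm) module_scheme \<Rightarrow> 'b set \<Rightarrow> bool" where
  "weakly_S_prime R S M N \<longleftrightarrow>
     submodule N R M \<and>
     colon R M N (carrier M) \<inter> S = {} \<and>
     (\<exists>s\<in>S. \<forall>a\<in>carrier R. \<forall>m\<in>carrier M.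
        a \<odot>\<^bsub>M\<^esub> m \<noteq> \<zero>\<^bsub>M\<^esub> \<and> a \<odot>\<^bsub>M\<^esub> m \<in> N \<longrightarrow>
        s \<otimes>\<^bsub>R\<^esub> a \<in> colon R M N (carrier M) \<or> s \<odot>\<^bsub>M\<^esub> m \<in> N)"

text \<open>
  The record type of modules extends that of rings, so the fields \<open>mult\<close> and \<open>one\<close> have to be
  filled in; the locale \<^locale>\<open>module\<close> does not constrain them. As with
  the product of cosets in a quotient ring, the union over representatives
  collapses to the single coset of \<open>a \<odot> x\<close> when \<open>K\<close> is a submodule.
\<close>

definition quot_module :: "('a, 'b, 'm) module_scheme \<Rightarrow> 'b set \<Rightarrow> ('a, 'b set) module" where
  "quot_module M K =
     \<lparr>carrier = a_rcosets\<^bsub>M\<^esub> K, mult = undefined, one = undefined,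
      zero = K, add = set_add M,
      smult = (\<lambda>a A. \<Union>x\<in>A. K +>\<^bsub>M\<^esub> (a \<odot>\<^bsub>M\<^esub> x))\<rparr>"

definition quot_submodule :: "('a, 'b, 'm) module_scheme \<Rightarrow> 'b set \<Rightarrow> 'b set \<Rightarrow> 'b set set" where
  "quot_submodule M N K = (\<lambda>n. K +>\<^bsub>M\<^esub> n) ` N"

lemma (in module) abelian_subgroup_of_submodule:
  assumes "submodule K R M"
  shows "abelian_subgroup K M"
  using assms by (intro abelian_subgroupI3 additive_subgroupI)
    (auto simp: submodule_def abelian_group_axioms)

lemma (in module) smult_quot_module:
  assumes K: "submodule K R M" and a: "a \<in> carrier R" and x: "x \<in> carrier M"
  shows "a \<odot>\<^bsub>quot_module M K\<^esub> (K +>\<^bsub>M\<^esub> x) = K +>\<^bsub>M\<^esub> (a \<odot>\<^bsub>M\<^esub> x)"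
proof -
  interpret K: abelian_subgroup K M
    by (rule abelian_subgroup_of_submodule[OF K])
  have "K +>\<^bsub>M\<^esub> (a \<odot>\<^bsub>M\<^esub> y) = K +>\<^bsub>M\<^esub> (a \<odot>\<^bsub>M\<^esub> x)" if y: "y \<in> K +>\<^bsub>M\<^esub> x" for y
  proof -
    from y obtain k where k: "k \<in> K" and y_eq: "y = k \<oplus>\<^bsub>M\<^esub> x"
      by (auto simp: a_r_coset_def')
    have kc: "k \<in> carrier M"
      using k K.a_subset by blast
    have "a \<odot>\<^bsub>M\<^esub> y = a \<odot>\<^bsub>M\<^esub> k \<oplus>\<^bsub>M\<^esub> a \<odot>\<^bsub>M\<^esub> x"
      using a kc x by (simp add: y_eq smult_r_distr)
    moreover have "a \<odot>\<^bsub>M\<^esub> k \<in> K"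
      using K a k by (rule submodule.smult_closed)
    ultimately have "a \<odot>\<^bsub>M\<^esub> y \<in> K +>\<^bsub>M\<^esub> (a \<odot>\<^bsub>M\<^esub> x)"
      by (auto simp: a_r_coset_def')
    then show ?thesis
      using a x a_repr_independence[OF _ _ K.a_subgroup] by (metis smult_closed)
  qed
  moreover have "x \<in> K +>\<^bsub>M\<^esub> x"
    using x by (rule K.a_rcos_self)
  ultimately have "(\<Union>y\<in>K +>\<^bsub>M\<^esub> x. K +>\<^bsub>M\<^esub> (a \<odot>\<^bsub>M\<^esub> y)) = K +>\<^bsub>M\<^esub> (a \<odot>\<^bsub>M\<^esub> x)"
    by blast
  then show ?thesis
    by (simp add: quot_module_def)
qed

lemma (in module) quot_module_is_module:
  assumes K: "submodule K R M"
  shows "module R (quot_module M K)"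
proof -
  interpret K: abelian_subgroup K M
    by (rule abelian_subgroup_of_submodule[OF K])
  have car: "carrier (quot_module M K) = (\<lambda>x. K +>\<^bsub>M\<^esub> x) ` carrier M"
    by (auto simp: quot_module_def A_RCOSETS_def')
  have add: "(K +>\<^bsub>M\<^esub> x) \<oplus>\<^bsub>quot_module M K\<^esub> (K +>\<^bsub>M\<^esub> y) = K +>\<^bsub>M\<^esub> (x \<oplus>\<^bsub>M\<^esub> y)"
    if "x \<in> carrier M" "y \<in> carrier M" for x y
    using that by (simp add: quot_module_def K.a_rcos_sum)
  have zero: "\<zero>\<^bsub>quot_module M K\<^esub> = K +>\<^bsub>M\<^esub> \<zero>\<^bsub>M\<^esub>"
    by (simp add: quot_module_def K.a_subset)
  have ab: "abelian_group (quot_module M K)"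
  proof (rule abelian_groupI)
    fix X assume "X \<in> carrier (quot_module M K)"
    then obtain x where x: "x \<in> carrier M" "X = K +>\<^bsub>M\<^esub> x"
      by (auto simp: car)
    show "\<exists>Y\<in>carrier (quot_module M K).
        Y \<oplus>\<^bsub>quot_module M K\<^esub> X = \<zero>\<^bsub>quot_module M K\<^esub>"
      by (rule bexI[of _ "K +>\<^bsub>M\<^esub> (\<ominus>\<^bsub>M\<^esub> x)"]) (auto simp: x car add zero M.l_neg)
  qed (auto simp: car add zero M.a_ac)
  show ?thesis
    by (rule moduleI)
      (auto simp: car add ab smult_quot_module[OF K] smult_l_distr smult_r_distr
        smult_assoc1 is_cring)
qed

end

theory Submission
  imports Defs
begin

text \<open>
  The two notions of primeness and the primeness of a quotient differ only in the products
  \<open>a \<odot> m\<close> that they exempt from the test: an \<open>S\<close>-prime submodule exempts none, a weakly \<open>S\<close>-prime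
  one exempts \<open>\<zero>\<close>, and \<open>N / K\<close> is weakly \<open>S\<close>-prime in \<open>M / K\<close> exactly when \<open>N\<close> passes the test in
  \<open>M\<close> for all products outside \<open>K\<close>, because \<open>K\<close> is the zero of \<open>M / K\<close>
  (\<open>weakly_S_prime_quot_iff\<close>). With the exempted set \<open>Z\<close> as a parameter (\<open>S_prime_outside\<close>),
  the claims about quotients reduce to two properties of that parameter. Exempting more products
  weakens the condition (\<open>S_prime_outside_mono\<close>); as \<open>{\<zero>} \<subseteq> K\<close>, weak primeness passes from \<open>N\<close> to
  \<open>N / K\<close>. And the condition is transitive (\<open>S_prime_outside_trans\<close>): if \<open>K\<close> passes the test
  outside \<open>Z\<close> and \<open>N\<close> passes it outside \<open>K\<close>, then \<open>N\<close> passes it outside \<open>Z\<close>, the product of the two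
  witnesses in \<open>S\<close> serving for both ranges of products. The choices \<open>Z = {}\<close> and \<open>Z = {\<zero>}\<close> give the
  two lifting claims.

  For the intersection \<open>K' \<inter> N\<close> the witness of \<open>K'\<close> itself works: \<open>N\<close> absorbs scalars, so
  membership in \<open>K'\<close> is all that has to be shown, and \<open>(K' : M) \<subseteq> (K' \<inter> N : N)\<close>
  (\<open>weakly_S_prime_Int\<close>).
\<close>

text \<open>
  Here \<open>Z\<close> is an arbitrary set and not a submodule, so that the empty set can be taken to
  recover \<open>S\<close>-primeness.
\<close>

definition S_prime_outside ::
  "('a, 'r) ring_scheme \<Rightarrow> 'a set \<Rightarrow> ('a, 'b, 'm) module_scheme \<Rightarrow> 'b set \<Rightarrow> 'b set \<Rightarrow> bool" where
  "S_prime_outside R S M Z N \<longleftrightarrow>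
     submodule N R M \<and>
     colon R M N (carrier M) \<inter> S = {} \<and>
     (\<exists>s\<in>S. \<forall>a\<in>carrier R. \<forall>m\<in>carrier M.
        a \<odot>\<^bsub>M\<^esub> m \<notin> Z \<and> a \<odot>\<^bsub>M\<^esub> m \<in> N \<longrightarrow>
        s \<otimes>\<^bsub>R\<^esub> a \<in> colon R M N (carrier M) \<or> s \<odot>\<^bsub>M\<^esub> m \<in> N)"

lemma S_prime_iff_outside_empty: "S_prime R S M N \<longleftrightarrow> S_prime_outside R S M {} N"
  by (simp add: S_prime_def S_prime_outside_def)

lemma weakly_S_prime_iff_outside_zero:
  "weakly_S_prime R S M N \<longleftrightarrow> S_prime_outside R S M {\<zero>\<^bsub>M\<^esub>} N"
  by (simp add: weakly_S_prime_def S_prime_outside_def)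

lemma S_prime_outside_mono:
  assumes "S_prime_outside R S M Z N" and "Z \<subseteq> Z'"
  shows "S_prime_outside R S M Z' N"
  using assms unfolding S_prime_outside_def by blast

lemma colon_mono: "N \<subseteq> N' \<Longrightarrow> K' \<subseteq> K \<Longrightarrow> colon R M N K \<subseteq> colon R M N' K'"
  by (auto simp: colon_def)

lemma (in module) mult_mem_colon:
  assumes "submodule N R M" and "L \<subseteq> carrier M" and "r \<in> carrier R" and "a \<in> colon R M N L"
  shows "r \<otimes>\<^bsub>R\<^esub> a \<in> colon R M N L"
proof -
  have a: "a \<in> carrier R" and aL: "\<And>x. x \<in> L \<Longrightarrow> a \<odot>\<^bsub>M\<^esub> x \<in> N"
    using assms(4) by (auto simp: colon_def)
  have "(r \<otimes>\<^bsub>R\<^esub> a) \<odot>\<^bsub>M\<^esub> x \<in> N" if "x \<in> L" for x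
    using that a aL assms(2,3) submoduleE(4)[OF assms(1,3)] by (simp add: smult_assoc1 subset_iff)
  with a assms(3) show ?thesis
    by (auto simp: colon_def)
qed

lemma (in module) zero_mem_submodule: "submodule N R M \<Longrightarrow> \<zero>\<^bsub>M\<^esub> \<in> N"
  using subgroup.one_closed[of N "add_monoid M"] by (simp add: submodule_def)

text \<open>
  A product \<open>a \<odot> m\<close> in \<open>N\<close> but outside \<open>Z\<close> is either outside \<open>K\<close>, where the witness \<open>s\<close> for \<open>N\<close>
  applies, or in \<open>K\<close>, where the witness \<open>t\<close> for \<open>K\<close> does. Either conclusion survives multiplication
  by the other witness, since \<open>N\<close> and its colon ideal absorb scalars and contain those of \<open>K\<close>.
\<close>

lemma (in module) S_prime_outside_trans:
  assumes S: "mult_closed R S" and KN: "K \<subseteq> N"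
    and N: "S_prime_outside R S M K N" and K: "S_prime_outside R S M Z K"
  shows "S_prime_outside R S M Z N"
proof -
  let ?I = "colon R M N (carrier M)"
  from N have subN: "submodule N R M" and disj: "?I \<inter> S = {}"
    by (simp_all add: S_prime_outside_def)
  from N obtain s where s: "s \<in> S"
    and sN: "\<And>a m. \<lbrakk>a \<in> carrier R; m \<in> carrier M; a \<odot>\<^bsub>M\<^esub> m \<notin> K; a \<odot>\<^bsub>M\<^esub> m \<in> N\<rbrakk> \<Longrightarrow>
      s \<otimes>\<^bsub>R\<^esub> a \<in> ?I \<or> s \<odot>\<^bsub>M\<^esub> m \<in> N"
    unfolding S_prime_outside_def by blast
  from K obtain t where t: "t \<in> S"
    and tK: "\<And>a m. \<lbrakk>a \<in> carrier R; m \<in> carrier M; a \<odot>\<^bsub>M\<^esub> m \<notin> Z; a \<odot>\<^bsub>M\<^esub> m \<in> K\<rbrakk> \<Longrightarrow>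
      t \<otimes>\<^bsub>R\<^esub> a \<in> colon R M K (carrier M) \<or> t \<odot>\<^bsub>M\<^esub> m \<in> K"
    unfolding S_prime_outside_def by blast
  from S s t have sR: "s \<in> carrier R" and tR: "t \<in> carrier R" and st: "s \<otimes>\<^bsub>R\<^esub> t \<in> S"
    by (auto simp: mult_closed_def)
  have "s \<otimes>\<^bsub>R\<^esub> t \<otimes>\<^bsub>R\<^esub> a \<in> ?I \<or> (s \<otimes>\<^bsub>R\<^esub> t) \<odot>\<^bsub>M\<^esub> m \<in> N"
    if a: "a \<in> carrier R" and m: "m \<in> carrier M"
      and am: "a \<odot>\<^bsub>M\<^esub> m \<notin> Z" "a \<odot>\<^bsub>M\<^esub> m \<in> N" for a m
  proof (cases "a \<odot>\<^bsub>M\<^esub> m \<in> K")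
    case True
    from tK[OF a m am(1) this] have "t \<otimes>\<^bsub>R\<^esub> a \<in> ?I \<or> t \<odot>\<^bsub>M\<^esub> m \<in> N"
      using KN colon_mono[OF KN subset_refl, of R M "carrier M"] by auto
    then have "s \<otimes>\<^bsub>R\<^esub> (t \<otimes>\<^bsub>R\<^esub> a) \<in> ?I \<or> s \<odot>\<^bsub>M\<^esub> (t \<odot>\<^bsub>M\<^esub> m) \<in> N"
      using mult_mem_colon[OF subN subset_refl sR] submodule.smult_closed[OF subN sR] by blast
    then show ?thesis
      using sR tR a m by (simp add: R.m_assoc smult_assoc1)
  next
    case False
    from sN[OF a m this am(2)] have "t \<otimes>\<^bsub>R\<^esub> (s \<otimes>\<^bsub>R\<^esub> a) \<in> ?I \<or> t \<odot>\<^bsub>M\<^esub> (s \<odot>\<^bsub>M\<^esub> m) \<in> N"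
      using mult_mem_colon[OF subN subset_refl tR] submodule.smult_closed[OF subN tR] by blast
    then show ?thesis
      using sR tR a m by (simp add: R.m_assoc[symmetric] R.m_comm[of s t] smult_assoc1)
  qed
  with st have "\<exists>u\<in>S. \<forall>a\<in>carrier R. \<forall>m\<in>carrier M. a \<odot>\<^bsub>M\<^esub> m \<notin> Z \<and> a \<odot>\<^bsub>M\<^esub> m \<in> N \<longrightarrow>
      u \<otimes>\<^bsub>R\<^esub> a \<in> ?I \<or> u \<odot>\<^bsub>M\<^esub> m \<in> N"
    by (intro bexI[of _ "s \<otimes>\<^bsub>R\<^esub> t"]) auto
  with subN disj show ?thesis
    by (simp add: S_prime_outside_def)
qed

lemma carrier_quot_module: "carrier (quot_module M K) = (\<lambda>x. K +>\<^bsub>M\<^esub> x) ` carrier M"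
  by (auto simp: quot_module_def A_RCOSETS_def')

lemma zero_quot_module: "\<zero>\<^bsub>quot_module M K\<^esub> = K"
  by (simp add: quot_module_def)

lemma (in module) coset_eq_submodule_iff:
  assumes K: "submodule K R M" and x: "x \<in> carrier M"
  shows "K +>\<^bsub>M\<^esub> x = K \<longleftrightarrow> x \<in> K"
proof -
  interpret K: abelian_subgroup K M
    by (rule abelian_subgroup_of_submodule[OF K])
  show ?thesis
    using K.a_rcos_const K.a_rcos_self[OF x] by auto
qed

text \<open>
  Since \<open>K \<subseteq> N\<close>, the submodule \<open>N\<close> is a union of cosets of \<open>K\<close>; a coset therefore lies in \<open>N / K\<close> as
  soon as one of its representatives lies in \<open>N\<close>.
\<close>

lemma (in module) coset_mem_quot_submodule_iff:
  assumes N: "submodule N R M" and K: "submodule K R M" and KN: "K \<subseteq> N" and x: "x \<in> carrier M"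
  shows "K +>\<^bsub>M\<^esub> x \<in> quot_submodule M N K \<longleftrightarrow> x \<in> N"
proof
  interpret K: abelian_subgroup K M
    by (rule abelian_subgroup_of_submodule[OF K])
  assume "K +>\<^bsub>M\<^esub> x \<in> quot_submodule M N K"
  then obtain n where n: "n \<in> N" and "K +>\<^bsub>M\<^esub> x = K +>\<^bsub>M\<^esub> n"
    by (auto simp: quot_submodule_def)
  with K.a_rcos_self[OF x] obtain k where "k \<in> K" and "x = k \<oplus>\<^bsub>M\<^esub> n"
    by (auto simp: a_r_coset_def')
  with n KN show "x \<in> N"
    using submoduleE(5)[OF N] by blast
qed (simp add: quot_submodule_def)

lemma (in module) submodule_quot_submodule:
  assumes N: "submodule N R M" and K: "submodule K R M" and KN: "K \<subseteq> N"
  shows "submodule (quot_submodule M N K) R (quot_module M K)"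
proof -
  interpret K: abelian_subgroup K M
    by (rule abelian_subgroup_of_submodule[OF K])
  interpret Q: module R "quot_module M K"
    by (rule quot_module_is_module[OF K])
  note Nc = submoduleE(1)[OF N]
  have sub: "quot_submodule M N K \<subseteq> carrier (quot_module M K)"
    using Nc by (auto simp: quot_submodule_def carrier_quot_module)
  have smult: "a \<odot>\<^bsub>quot_module M K\<^esub> X \<in> quot_submodule M N K"
    if "a \<in> carrier R" "X \<in> quot_submodule M N K" for a X
    using that Nc submoduleE(4)[OF N]
    by (auto simp: quot_submodule_def smult_quot_module[OF K] subset_iff)
  show ?thesis
  proof (rule Q.submoduleI)
    show "\<zero>\<^bsub>quot_module M K\<^esub> \<in> quot_submodule M N K"
      using coset_mem_quot_submodule_iff[OF N K KN] zero_mem_submodule[OF N]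
        coset_eq_submodule_iff[OF K] zero_mem_submodule[OF K]
      by (metis zero_quot_module M.zero_closed)
  next
    fix X assume X: "X \<in> quot_submodule M N K"
    \<comment> \<open>Negation is the scalar \<open>\<ominus> \<one>\<close>, so this case is an instance of closure under scalars.\<close>
    then have "(\<ominus>\<^bsub>R\<^esub> \<one>\<^bsub>R\<^esub>) \<odot>\<^bsub>quot_module M K\<^esub> X = \<ominus>\<^bsub>quot_module M K\<^esub> X"
      using sub by (auto simp: Q.smult_l_minus subset_iff)
    with smult[OF _ X] show "\<ominus>\<^bsub>quot_module M K\<^esub> X \<in> quot_submodule M N K"
      by (metis R.a_inv_closed R.one_closed)
  next
    fix X Y assume "X \<in> quot_submodule M N K" "Y \<in> quot_submodule M N K"
    then show "X \<oplus>\<^bsub>quot_module M K\<^esub> Y \<in> quot_submodule M N K"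
      using Nc submoduleE(5)[OF N]
      by (auto simp: quot_submodule_def quot_module_def K.a_rcos_sum subset_iff)
  qed (use sub smult in auto)
qed

lemma (in module) colon_quot_module:
  assumes N: "submodule N R M" and K: "submodule K R M" and KN: "K \<subseteq> N"
  shows "colon R (quot_module M K) (quot_submodule M N K) (carrier (quot_module M K)) =
    colon R M N (carrier M)"
  by (auto simp: colon_def carrier_quot_module image_subset_iff smult_quot_module[OF K]
      coset_mem_quot_submodule_iff[OF N K KN])

text \<open>
  Every element of \<open>M / K\<close> is a coset of some \<open>m\<close> in \<open>M\<close>, so the test in the quotient can be read on
  representatives: \<open>a \<odot> (K + m)\<close> is zero iff \<open>a \<odot> m\<close> lies in \<open>K\<close>, it lies in \<open>N / K\<close> iff \<open>a \<odot> m\<close>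
  lies in \<open>N\<close>, and the colon ideals \<open>(N / K : M / K)\<close> and \<open>(N : M)\<close> coincide.
\<close>

lemma (in module) weakly_S_prime_quot_iff:
  assumes N: "submodule N R M" and K: "submodule K R M" and KN: "K \<subseteq> N"
    and S: "S \<subseteq> carrier R"
  shows "weakly_S_prime R S (quot_module M K) (quot_submodule M N K) \<longleftrightarrow>
    S_prime_outside R S M K N"
proof -
  have "(a \<odot>\<^bsub>quot_module M K\<^esub> (K +>\<^bsub>M\<^esub> m) \<in> quot_submodule M N K \<longleftrightarrow> a \<odot>\<^bsub>M\<^esub> m \<in> N) \<and>
      (a \<odot>\<^bsub>quot_module M K\<^esub> (K +>\<^bsub>M\<^esub> m) = \<zero>\<^bsub>quot_module M K\<^esub> \<longleftrightarrow> a \<odot>\<^bsub>M\<^esub> m \<in> K)"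
    if "a \<in> carrier R" "m \<in> carrier M" for a m
    using that
    by (simp add: smult_quot_module[OF K] coset_mem_quot_submodule_iff[OF N K KN]
        zero_quot_module coset_eq_submodule_iff[OF K])
  with S show ?thesis
    by (simp add: weakly_S_prime_def S_prime_outside_def carrier_quot_module
        colon_quot_module[OF N K KN, unfolded carrier_quot_module]
        submodule_quot_submodule[OF N K KN] N subset_iff cong: bex_cong)
qed

lemma (in module) submodule_Int_carrier_update:
  assumes N: "submodule N R M" and L: "submodule L R M"
  shows "submodule (L \<inter> N) R (M\<lparr>carrier := N\<rparr>)"
proof -
  have "submodule (L \<inter> N) R M"
  proof (rule submoduleI)
    show "L \<inter> N \<subseteq> carrier M"
      using submoduleE(1)[OF N] by blast
  qed (use N L zero_mem_submodule submoduleE(3,4,5) in auto)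
  \<comment> \<open>Replacing the carrier \<open>N\<close> by \<open>L \<inter> N\<close> gives the same module as replacing the carrier of
      \<open>M\<close>, so \<open>L \<inter> N\<close> is a submodule of \<open>N\<close> because it is a module inside it.\<close>
  then have "module R (M\<lparr>carrier := L \<inter> N\<rparr>)"
    by (rule submodule.submodule_is_module) (rule module_axioms)
  then show ?thesis
    by (intro module.module_incl_imp_submodule submodule.submodule_is_module[OF N])
      (auto intro: module_axioms)
qed

text \<open>
  Because \<open>N\<close> is closed under scalars, \<open>(L \<inter> N : N) = (L : N)\<close>, which contains \<open>(L : M)\<close>. Hence any
  witness for \<open>L\<close> in \<open>M\<close> is one for \<open>L \<inter> N\<close> in \<open>N\<close>; only disjointness from \<open>S\<close> can be lost when
  the colon ideal grows, and it is therefore assumed for \<open>(L : N)\<close>.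
\<close>

lemma (in module) weakly_S_prime_Int:
  assumes N: "submodule N R M" and L: "weakly_S_prime R S M L"
    and S: "S \<subseteq> carrier R" and disj: "colon R M L N \<inter> S = {}"
  shows "weakly_S_prime R S (M\<lparr>carrier := N\<rparr>) (L \<inter> N)"
proof -
  note Nc = submoduleE(1)[OF N]
  have colon_eq: "colon R (M\<lparr>carrier := N\<rparr>) (L \<inter> N) N = colon R M L N"
    using submoduleE(4)[OF N] by (auto simp: colon_def)
  have "submodule L R M"
    using L by (simp add: weakly_S_prime_def)
  note sub = submodule_Int_carrier_update[OF N this]
  from L obtain s where s: "s \<in> S"
    and sL: "\<And>a m. \<lbrakk>a \<in> carrier R; m \<in> carrier M; a \<odot>\<^bsub>M\<^esub> m \<noteq> \<zero>\<^bsub>M\<^esub>; a \<odot>\<^bsub>M\<^esub> m \<in> L\<rbrakk> \<Longrightarrow>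
      s \<otimes>\<^bsub>R\<^esub> a \<in> colon R M L (carrier M) \<or> s \<odot>\<^bsub>M\<^esub> m \<in> L"
    unfolding weakly_S_prime_def by auto
  have "s \<otimes>\<^bsub>R\<^esub> a \<in> colon R M L N \<or> s \<odot>\<^bsub>M\<^esub> m \<in> L \<inter> N"
    if "a \<in> carrier R" "m \<in> N" "a \<odot>\<^bsub>M\<^esub> m \<noteq> \<zero>\<^bsub>M\<^esub>" "a \<odot>\<^bsub>M\<^esub> m \<in> L" for a m
  proof -
    have "s \<odot>\<^bsub>M\<^esub> m \<in> N"
      using s S that(2) submoduleE(4)[OF N] by auto
    moreover have "s \<otimes>\<^bsub>R\<^esub> a \<in> colon R M L (carrier M) \<or> s \<odot>\<^bsub>M\<^esub> m \<in> L"
      using that Nc by (intro sL) auto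
    ultimately show ?thesis
      using colon_mono[OF subset_refl Nc, of R M L] by auto
  qed
  with s disj sub show ?thesis
    unfolding weakly_S_prime_def by (simp add: colon_eq) blast
qed

theorem corollary3:
  fixes R :: "('a, 'r) ring_scheme" and M :: "('a, 'b, 'm) module_scheme"
    and S :: "'a set" and N K :: "'b set"
  assumes "module R M" and "\<one>\<^bsub>R\<^esub> \<noteq> \<zero>\<^bsub>R\<^esub>"
    and "mult_closed R S"
    and "submodule N R M" and "submodule K R M" and "K \<subseteq> N"
  shows "(weakly_S_prime R S M N \<longrightarrow>
            weakly_S_prime R S (quot_module M K) (quot_submodule M N K)) \<and>
         (\<forall>K'. weakly_S_prime R S M K' \<and> colon R M K' N \<inter> S = {} \<longrightarrow>
            weakly_S_prime R S (M\<lparr>carrier := N\<rparr>) (K' \<inter> N)) \<and>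
         (weakly_S_prime R S (quot_module M K) (quot_submodule M N K) \<and> S_prime R S M K \<longrightarrow>
            S_prime R S M N) \<and>
         (weakly_S_prime R S (quot_module M K) (quot_submodule M N K) \<and> weakly_S_prime R S M K \<longrightarrow>
            weakly_S_prime R S M N)"
proof -
  interpret module R M
    by fact
  have S: "S \<subseteq> carrier R"
    using assms(3) by (simp add: mult_closed_def)
  note quot_iff = weakly_S_prime_quot_iff[OF assms(4-6) S]
  note trans = S_prime_outside_trans[OF assms(3,6)]
  have "{\<zero>\<^bsub>M\<^esub>} \<subseteq> K"
    using zero_mem_submodule[OF assms(5)] by simp
  \<comment> \<open>Weak primeness of \<open>N\<close> exempts \<open>\<zero>\<close>; enlarging the exempted set to \<open>K\<close> yields \<open>N / K\<close>.\<close>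
  note mono = S_prime_outside_mono[OF _ this]
  show ?thesis
    using mono trans weakly_S_prime_Int[OF assms(4) _ S]
    unfolding quot_iff S_prime_iff_outside_empty
    by (auto simp: weakly_S_prime_iff_outside_zero)
qed

end
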